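(* Let $n,p,m$ be positive integers, $\Sigma\in\mathbb C^{p\times p}$ a full rank Hermitian covariance matrix, $M$ as in the definition of $W(n)=W_p(n,\Sigma,M)$, $\Omega=\Sigma^{-1}M$, and $H_1,\ldots,H_m\in\mathbb C^{p\times p}$. For every nonzero multi-index $\boldsymbol i=(i_1,\ldots,i_m)\in\mathbb N_0^m$, $$\mathrm{Cum}_{\boldsymbol i}(\mathrm{Tr}[W(n)H_1],\ldots,\mathrm{Tr}[W(n)H_m])=\boldsymbol i!\,\big(n\,E[\boldsymbol\rho^{\boldsymbol i}]-E[\boldsymbol\eta^{\boldsymbol i}]\big),$$ where $$E[\boldsymbol\rho^{\boldsymbol i}]=\sum_{\mathfrak a\in\boldsymbol M_m[\boldsymbol i]}\mathrm{Tr}\Big[\prod_{k\in\mathfrak a}(\Sigma H_k)\Big]+\sum_{\mathfrak a\in\boldsymbol N_m[\boldsymbol i]-\boldsymbol M_m[\boldsymbol i]}\frac1{d_{\mathfrak a}}\mathrm{Tr}\Big[\prod_{k\in\mathfrak a}(\Sigma H_k)\Big],\qquad d_{\mathfrak a}=\frac{|\boldsymbol i|}{\text{period of }\mathfrak a},$$ $$E[\boldsymbol\eta^{\boldsymbol i}]=\sum_{\mathfrak a\in\boldsymbol N_m[\boldsymbol i]}\Big(\sum_{b\in[\mathfrak a]}\mathrm{Tr}\Big[\Omega\prod_{k\in b}(\Sigma H_k)\Big]\Big).$$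
   Context: **Necklaces.** For $\boldsymbol i=(i_1,\ldots,i_m)$, $|\boldsymbol i|=i_1+\cdots+i_m$ and $\boldsymbol i!=i_1!\cdots i_m!$. An $m$-ary necklace of length $|\boldsymbol i|$ is an equivalence class, under cyclic rotation, of strings in $\{1,\ldots,m\}^{|\boldsymbol i|}$; its representative $\mathfrak a$ is its lexicographically smallest string and the necklace is written $[\mathfrak a]$ (a set of distinct strings). The period of a necklace is its cardinality; it is aperiodic if the period is $|\boldsymbol i|$. A necklace is of kind $\boldsymbol i$ if its strings contain the letter $j$ exactly $i_j$ times. $\boldsymbol N_m[\boldsymbol i]$ is the set of representatives of necklaces of kind $\boldsymbol i$, and $\boldsymbol M_m[\boldsymbol i]$ the subset of representatives of aperiodic ones. Products are taken in the order of the letters of the string. ($\boldsymbol\rho$ and $\boldsymbol\eta$ are $m$-tuples of umbral monomials, i.e. formal symbols whose multivariate moments are the displayed scalars; only these scalars matter here.) **Joint cumulants.** $\mathrm{Cum}_{\boldsymbol i}$ is $\boldsymbol i!$ times the coefficient of $\boldsymbol z^{\boldsymbol i}$ in the logarithm of the joint (exponential) moment generating function, as a formal power series in $z_1,\ldots,z_m$. **Wishart matrices.** $W(n)=\sum_{i=1}^n(X_{(i)}-\boldsymbol m_i)^\dagger(X_{(i)}-\boldsymbol m_i)$, with $X_{(i)}$ independent $p$-variate complex normal row vectors with zero mean and full rank Hermitian covariance $\Sigma$, $\boldsymbol m_i$ row vectors, $M=\sum_{i=1}^n\boldsymbol m_i^\dagger\boldsymbol m_i$. **Moment convention:** the joint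 moment generating function of $(\mathrm{Tr}[W(n)H_1],\ldots,\mathrm{Tr}[W(n)H_m])$ is taken to be $$E(\exp\{\mathrm{Tr}[W(n)Z]\})=\frac{\exp\{-\mathrm{Tr}[(I_p-\Sigma Z)^{-1}\Omega\,\Sigma Z]\}}{[\det(I_p-\Sigma Z)]^n},\qquad Z=H_1z_1+\cdots+H_mz_m,$$ read as a formal power series in $z_1,\ldots,z_m$. *)

theory Defs
  imports
    "HOL-Analysis.Analysis"
    "HOL-Computational_Algebra.Formal_Power_Series"
    "HOL-Library.Poly_Mapping"
    "HOL-Library.List_Lexorder"
begin

text \<open>
  A multi-index $(i_1, \ldots, i_m)$ is a finitely supported function from \<^typ>\<open>nat\<close> to
  \<^typ>\<open>nat\<close> whose support lies in \<open>{1..m}\<close>.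
\<close>

definition mi_size :: "('v \<Rightarrow>\<^sub>0 nat) \<Rightarrow> nat" where
  "mi_size i = (\<Sum>v\<in>Poly_Mapping.keys i. Poly_Mapping.lookup i v)"

definition mi_fact :: "('v \<Rightarrow>\<^sub>0 nat) \<Rightarrow> nat" where
  "mi_fact i = (\<Prod>v\<in>Poly_Mapping.keys i. fact (Poly_Mapping.lookup i v))"

definition mi_splits :: "('v \<Rightarrow>\<^sub>0 nat) \<Rightarrow> (('v \<Rightarrow>\<^sub>0 nat) \<times> ('v \<Rightarrow>\<^sub>0 nat)) set" where
  "mi_splits i = {(j, k). j + k = i}"

lemma finite_mi_splits [simp]: "finite (mi_splits i)"
proof -
  let ?r = "\<lambda>p. restrict (Poly_Mapping.lookup (fst p)) (Poly_Mapping.keys i)"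
  have inj: "inj_on ?r (mi_splits i)"
  proof (rule inj_onI)
    fix p q assume p: "p \<in> mi_splits i" and q: "q \<in> mi_splits i" and eq: "?r p = ?r q"
    obtain a b where ab: "p = (a, b)" by (cases p)
    obtain c d where cd: "q = (c, d)" by (cases q)
    have sums: "a + b = i" "c + d = i" using p q by (auto simp: ab cd mi_splits_def)
    have "Poly_Mapping.lookup a v = Poly_Mapping.lookup c v" for v
    proof (cases "v \<in> Poly_Mapping.keys i")
      case True
      then show ?thesis using fun_cong[OF eq, of v] by (simp add: ab cd)
    next
      case False
      then have "Poly_Mapping.lookup (a + b) v = 0" "Poly_Mapping.lookup (c + d) v = 0"
        using sums by (simp_all add: in_keys_iff)
      then show ?thesis by (simp add: lookup_add)
    qed
    then have "a = c" by (rule poly_mapping_eqI)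
    moreover have "b = d" using sums \<open>a = c\<close> by auto
    ultimately show "p = q" by (simp add: ab cd)
  qed
  have "?r ` mi_splits i \<subseteq> PiE (Poly_Mapping.keys i) (\<lambda>v. {..Poly_Mapping.lookup i v})"
    by (auto simp: mi_splits_def lookup_add)
  moreover have "finite (PiE (Poly_Mapping.keys i) (\<lambda>v. {..Poly_Mapping.lookup i v}))"
    by (intro finite_PiE) auto
  ultimately show ?thesis using inj by (meson inj_on_finite)
qed

typedef ('v, 'a) mfps = "UNIV :: (('v \<Rightarrow>\<^sub>0 nat) \<Rightarrow> 'a) set"
  morphisms mfps_nth Abs_mfps
  by simp

lemma mfps_nth_Abs_mfps [simp]: "mfps_nth (Abs_mfps f) i = f i"
  by (simp add: Abs_mfps_inverse)

lemma mfps_eqI: "(\<And>i. mfps_nth f i = mfps_nth g i) \<Longrightarrow> f = g"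
  by (simp add: mfps_nth_inject[symmetric] fun_eq_iff)

instantiation mfps :: (type, comm_ring_1) comm_ring_1
begin

definition zero_mfps where
  "(0 :: ('a, 'b) mfps) = Abs_mfps (\<lambda>i. 0)"

definition one_mfps where
  "(1 :: ('a, 'b) mfps) = Abs_mfps (\<lambda>i. if i = 0 then 1 else 0)"

definition plus_mfps where
  "(f :: ('a, 'b) mfps) + g = Abs_mfps (\<lambda>i. mfps_nth f i + mfps_nth g i)"

definition minus_mfps where
  "(f :: ('a, 'b) mfps) - g = Abs_mfps (\<lambda>i. mfps_nth f i - mfps_nth g i)"

definition uminus_mfps where
  "- (f :: ('a, 'b) mfps) = Abs_mfps (\<lambda>i. - mfps_nth f i)"

definition times_mfps where
  "(f :: ('a, 'b) mfps) * g =
    Abs_mfps (\<lambda>i. \<Sum>(j, k)\<in>mi_splits i. mfps_nth f j * mfps_nth g k)"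

instance
proof
  fix f g h :: "('a, 'b) mfps"
  show "f + g + h = f + (g + h)" "f + g = g + f" "0 + f = f" "- f + f = 0" "f - g = f + - g"
    by (auto intro!: mfps_eqI simp: plus_mfps_def zero_mfps_def minus_mfps_def uminus_mfps_def)
  show "(f + g) * h = f * h + g * h"
    by (auto intro!: mfps_eqI
        simp: plus_mfps_def times_mfps_def sum.distrib[symmetric] algebra_simps case_prod_unfold)
  show "f * g = g * f"
  proof (rule mfps_eqI)
    fix i
    show "mfps_nth (f * g) i = mfps_nth (g * f) i"
      unfolding times_mfps_def mfps_nth_Abs_mfps
      by (rule sum.reindex_bij_witness[where i = prod.swap and j = prod.swap])
        (auto simp: mi_splits_def add.commute mult.commute)
  qed
  show "1 * f = f"
  proof (rule mfps_eqI)
    fix i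
    have "mfps_nth (1 * f) i =
        (\<Sum>p\<in>mi_splits i. if p = (0, i) then mfps_nth f i else 0)"
      unfolding times_mfps_def one_mfps_def mfps_nth_Abs_mfps
      by (rule sum.cong) (auto simp: mi_splits_def split: if_splits)
    also have "\<dots> = mfps_nth f i"
      by (simp add: sum.delta) (simp add: mi_splits_def)
    finally show "mfps_nth (1 * f) i = mfps_nth f i" .
  qed
  show "f * g * h = f * (g * h)"
  proof (rule mfps_eqI)
    fix i
    have "mfps_nth (f * g * h) i =
        (\<Sum>(p, q)\<in>(SIGMA p:mi_splits i. mi_splits (fst p)).
          mfps_nth f (fst q) * mfps_nth g (snd q) * mfps_nth h (snd p))"
      by (simp add: times_mfps_def case_prod_unfold sum_distrib_right sum.Sigma)
    also have "\<dots> = (\<Sum>(p, q)\<in>(SIGMA p:mi_splits i. mi_splits (snd p)).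
          mfps_nth f (fst p) * (mfps_nth g (fst q) * mfps_nth h (snd q)))"
      by (rule sum.reindex_bij_witness
          [where i = "\<lambda>((a, b), (c, d)). ((a + c, d), (a, c))"
             and j = "\<lambda>((a, b), (c, d)). ((c, d + b), (d, b))"])
        (auto simp: mi_splits_def add.assoc mult.assoc)
    also have "\<dots> = mfps_nth (f * (g * h)) i"
      by (simp add: times_mfps_def case_prod_unfold sum_distrib_left sum.Sigma)
    finally show "mfps_nth (f * g * h) i = mfps_nth (f * (g * h)) i" .
  qed
  show "(0 :: ('a, 'b) mfps) \<noteq> 1"
  proof
    assume "(0 :: ('a, 'b) mfps) = 1"
    then have "mfps_nth (0 :: ('a, 'b) mfps) 0 = mfps_nth 1 0" by simp
    then show False by (simp add: zero_mfps_def one_mfps_def)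
  qed
qed

end

text \<open>As for univariate series, the inverse of a non-invertible series is \<open>0\<close>.\<close>

instantiation mfps :: (type, comm_ring_1) inverse
begin

definition inverse_mfps where
  "inverse (f :: ('a, 'b) mfps) = (if f dvd 1 then (THE g. f * g = 1) else 0)"

definition divide_mfps where
  "(f :: ('a, 'b) mfps) div g = f * inverse g"

instance ..

end

definition mfps_const :: "'a::comm_ring_1 \<Rightarrow> ('v, 'a) mfps" where
  "mfps_const c = Abs_mfps (\<lambda>i. if i = 0 then c else 0)"

definition mfps_var :: "'v \<Rightarrow> ('v, 'a::comm_ring_1) mfps" where
  "mfps_var v = Abs_mfps (\<lambda>i. if i = Poly_Mapping.single v 1 then 1 else 0)"

text \<open>
  The substitution $F(g) = \sum_k F_k g^k$ of a series $g$ into a univariate series $F$, meaningful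
  when $g$ has zero constant term; then $g^k$ has no terms of total degree below $k$, so the sum for
  the coefficient at \<open>i\<close> may be truncated, exactly as in \<^const>\<open>fps_compose\<close>.
\<close>

definition mfps_subst :: "'a::comm_ring_1 fps \<Rightarrow> ('v, 'a) mfps \<Rightarrow> ('v, 'a) mfps" where
  "mfps_subst F g = Abs_mfps (\<lambda>i. \<Sum>k\<le>mi_size i. fps_nth F k * mfps_nth (g ^ k) i)"

definition mfps_exp :: "('v, 'a::field_char_0) mfps \<Rightarrow> ('v, 'a) mfps" where
  "mfps_exp g = mfps_subst (fps_exp 1) g"

text \<open>\<^term>\<open>fps_ln 1\<close> is the series of $\ln (1 + X)$; \<open>f\<close> must have constant term \<open>1\<close>.\<close>

definition mfps_ln :: "('v, 'a::field_char_0) mfps \<Rightarrow> ('v, 'a) mfps" where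
  "mfps_ln f = mfps_subst (fps_ln 1) (f - 1)"

definition joint_cumulant :: "('v, complex) mfps \<Rightarrow> ('v \<Rightarrow>\<^sub>0 nat) \<Rightarrow> complex" where
  "joint_cumulant G i = of_nat (mi_fact i) * mfps_nth (mfps_ln G) i"

definition conj_transpose :: "complex^'a^'b \<Rightarrow> complex^'b^'a" where
  "conj_transpose A = map_matrix cnj (transpose A)"

text \<open>
  Covariance matrices of complex random vectors: Hermitian and positive semidefinite. The quadratic
  form of a Hermitian matrix is real, so taking the real part loses nothing.
\<close>

definition covariance_matrix :: "complex^'p^'p \<Rightarrow> bool" where
  "covariance_matrix S \<longleftrightarrow>
    conj_transpose S = S \<and>
    (\<forall>x :: complex^'p. 0 \<le> Re (\<Sum>r\<in>UNIV. \<Sum>s\<in>UNIV. cnj (x $ r) * S $ r $ s * x $ s))"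

definition const_matrix :: "complex^'a^'b \<Rightarrow> ((nat, complex) mfps)^'a^'b" where
  "const_matrix A = map_matrix mfps_const A"

text \<open>$Z = H_1 z_1 + \cdots + H_m z_m$.\<close>

definition var_matrix :: "nat \<Rightarrow> (nat \<Rightarrow> complex^'p^'p) \<Rightarrow> ((nat, complex) mfps)^'p^'p" where
  "var_matrix m H = (\<Sum>k=1..m. map_matrix (\<lambda>c. mfps_const c * mfps_var k) (H k))"

text \<open>
  The joint moment generating function of
  $(\mathrm{Tr}[W(n) H_1], \ldots, \mathrm{Tr}[W(n) H_m])$ as a formal power series, with \<open>S\<close> the
  covariance matrix and \<open>Om\<close> the matrix $\Omega = \Sigma^{-1} M$. The law of $W(n)$ enters only
  through this series; the sign in the exponent is part of the convention. \<^const>\<open>matrix_inv\<close> and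
  \<^const>\<open>det\<close> are taken over the ring of formal power series.
\<close>

definition wishart_mgf ::
  "nat \<Rightarrow> complex^'p^'p \<Rightarrow> complex^'p^'p \<Rightarrow> nat \<Rightarrow> (nat \<Rightarrow> complex^'p^'p) \<Rightarrow> (nat, complex) mfps"
where
  "wishart_mgf n S Om m H =
    (let SZ = const_matrix S ** var_matrix m H in
      mfps_exp (- trace (matrix_inv (mat 1 - SZ) ** const_matrix Om ** SZ)) / det (mat 1 - SZ) ^ n)"

definition strings :: "nat \<Rightarrow> nat \<Rightarrow> nat list set" where
  "strings m l = {s. set s \<subseteq> {1..m} \<and> length s = l}"

definition rotation_rel :: "(nat list \<times> nat list) set" where
  "rotation_rel = {(s, t). \<exists>k. t = rotate k s}"

definition necklaces :: "nat \<Rightarrow> nat \<Rightarrow> nat list set set" where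
  "necklaces m l = strings m l // rotation_rel"

definition necklaces_of_kind :: "nat \<Rightarrow> (nat \<Rightarrow>\<^sub>0 nat) \<Rightarrow> nat list set set" where
  "necklaces_of_kind m i =
    {A \<in> necklaces m (mi_size i). \<forall>s\<in>A. \<forall>j\<in>{1..m}. count_list s j = Poly_Mapping.lookup i j}"

text \<open>\<^const>\<open>Min\<close> refers to the lexicographic order on \<^typ>\<open>nat list\<close>.\<close>

definition necklace_reps :: "nat \<Rightarrow> (nat \<Rightarrow>\<^sub>0 nat) \<Rightarrow> nat list set" where
  "necklace_reps m i = Min ` necklaces_of_kind m i"

definition aperiodic_necklace_reps :: "nat \<Rightarrow> (nat \<Rightarrow>\<^sub>0 nat) \<Rightarrow> nat list set" where
  "aperiodic_necklace_reps m i = Min ` {A \<in> necklaces_of_kind m i. card A = mi_size i}"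

definition necklace :: "nat list \<Rightarrow> nat list set" where
  "necklace a = rotation_rel `` {a}"

definition necklace_period :: "nat list \<Rightarrow> nat" where
  "necklace_period a = card (necklace a)"

definition string_prod :: "(nat \<Rightarrow> complex^'p^'p) \<Rightarrow> nat list \<Rightarrow> complex^'p^'p" where
  "string_prod A s = foldr (\<lambda>k P. A k ** P) s (mat 1)"

definition rho_moment ::
  "nat \<Rightarrow> complex^'p^'p \<Rightarrow> (nat \<Rightarrow> complex^'p^'p) \<Rightarrow> (nat \<Rightarrow>\<^sub>0 nat) \<Rightarrow> complex"
where
  "rho_moment m S H i =
    (\<Sum>a\<in>aperiodic_necklace_reps m i. trace (string_prod (\<lambda>k. S ** H k) a)) +
    (\<Sum>a\<in>necklace_reps m i - aperiodic_necklace_reps m i.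
      1 / (of_nat (mi_size i) / of_nat (necklace_period a)) *
      trace (string_prod (\<lambda>k. S ** H k) a))"

definition eta_moment ::
  "nat \<Rightarrow> complex^'p^'p \<Rightarrow> complex^'p^'p \<Rightarrow> (nat \<Rightarrow> complex^'p^'p) \<Rightarrow> (nat \<Rightarrow>\<^sub>0 nat) \<Rightarrow> complex"
where
  "eta_moment m S Om H i =
    (\<Sum>a\<in>necklace_reps m i. \<Sum>b\<in>necklace a. trace (Om ** string_prod (\<lambda>k. S ** H k) b))"

end

theory Submission
  imports Defs
begin

text \<open>
  Let $A = \Sigma Z$ and $N = (I - A)^{-1}$. The coefficient of $N$ at $z^i$ is the sum of
  $\prod_{k \in w} (\Sigma H_k)$ over all words $w$ of kind $i$, and the moment generating function
  is $G = \exp(-T) (\det N)^n$ with $T = \mathrm{Tr}[\Omega (N - I)]$. Apply the Euler derivation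
  $D = \sum_k z_k \partial_k$, which multiplies the coefficient at $z^i$ by $|i|$. As $A$ is linear,
  $D A = A$, so $D N = (N A) N$ and $D \det N = \mathrm{Tr}[N A] \det N$, whence
  $D \log G = n \mathrm{Tr}[N - I] - D T$. Comparing coefficients expresses the cumulant as a sum
  over words, which is then grouped by necklaces: a necklace of period $q$ contributes $q$ words
  with equal trace, and hence $q / |i|$ times that trace.
\<close>

section \<open>Multivariate power series\<close>

lemma mi_size_sum:
  assumes "finite V" "Poly_Mapping.keys i \<subseteq> V"
  shows "mi_size i = (\<Sum>v\<in>V. Poly_Mapping.lookup i v)"
  unfolding mi_size_def using assms
  by (intro sum.mono_neutral_left) (auto simp: in_keys_iff)

lemma mi_size_0 [simp]: "mi_size 0 = 0"
  by (simp add: mi_size_def)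

lemma mi_size_single [simp]: "mi_size (Poly_Mapping.single v c) = c"
  by (cases "c = 0") (simp_all add: mi_size_def)

lemma mi_size_add: "mi_size (i + j) = mi_size i + mi_size j"
proof -
  let ?V = "Poly_Mapping.keys i \<union> Poly_Mapping.keys j"
  have "mi_size (i + j) = (\<Sum>v\<in>?V. Poly_Mapping.lookup (i + j) v)"
    by (rule mi_size_sum) (simp_all add: Poly_Mapping.keys_add)
  also have "\<dots> = mi_size i + mi_size j"
    by (simp add: lookup_add sum.distrib mi_size_sum[of ?V i] mi_size_sum[of ?V j])
  finally show ?thesis .
qed

lemma mi_size_eq_0_iff: "mi_size i = 0 \<longleftrightarrow> i = 0"
proof
  assume "mi_size i = 0"
  then show "i = 0"
    by (auto simp: mi_size_def in_keys_iff intro!: poly_mapping_eqI)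
qed simp

lemma mi_splits_0: "mi_splits 0 = {(0, 0)}"
proof -
  have "j + k = 0 \<longleftrightarrow> j = 0 \<and> k = 0" for j k :: "'a \<Rightarrow>\<^sub>0 nat"
    using mi_size_eq_0_iff[of "j + k"] by (simp add: mi_size_add mi_size_eq_0_iff)
  then show ?thesis by (auto simp: mi_splits_def)
qed

lemma mfps_nth_0 [simp]: "mfps_nth 0 i = 0"
  by (simp add: zero_mfps_def)

lemma mfps_nth_1: "mfps_nth 1 i = (if i = 0 then 1 else 0)"
  by (simp add: one_mfps_def)

lemma mfps_nth_add [simp]: "mfps_nth (f + g) i = mfps_nth f i + mfps_nth g i"
  by (simp add: plus_mfps_def)

lemma mfps_nth_diff [simp]: "mfps_nth (f - g) i = mfps_nth f i - mfps_nth g i"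
  by (simp add: minus_mfps_def)

lemma mfps_nth_uminus [simp]: "mfps_nth (- f) i = - mfps_nth f i"
  by (simp add: uminus_mfps_def)

lemma mfps_nth_sum [simp]: "mfps_nth (sum f A) i = (\<Sum>x\<in>A. mfps_nth (f x) i)"
  by (induction A rule: infinite_finite_induct) simp_all

lemma mfps_nth_mult:
  "mfps_nth (f * g) i = (\<Sum>p\<in>mi_splits i. mfps_nth f (fst p) * mfps_nth g (snd p))"
  by (simp add: times_mfps_def case_prod_unfold)

lemma mfps_nth_mult_0 [simp]: "mfps_nth (f * g) 0 = mfps_nth f 0 * mfps_nth g 0"
  by (simp add: mfps_nth_mult mi_splits_0)

lemma mfps_nth_power_0 [simp]: "mfps_nth (f ^ k) 0 = mfps_nth f 0 ^ k"
  by (induction k) (simp_all add: mfps_nth_1)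

lemma mfps_nth_const_mult [simp]: "mfps_nth (mfps_const c * f) i = c * mfps_nth f i"
proof -
  have "mfps_nth (mfps_const c * f) i =
      (\<Sum>p\<in>mi_splits i. if p = (0, i) then c * mfps_nth f i else 0)"
    unfolding mfps_nth_mult mfps_const_def mfps_nth_Abs_mfps
    by (rule sum.cong) (auto simp: mi_splits_def split: if_splits)
  moreover have "(0, i) \<in> mi_splits i" by (simp add: mi_splits_def)
  ultimately show ?thesis by simp
qed

lemma mfps_nth_of_nat_mult [simp]: "mfps_nth (of_nat n * f) i = of_nat n * mfps_nth f i"
  by (induction n) (simp_all add: algebra_simps)

lemma mfps_const_1: "mfps_const 1 = 1"
  by (simp add: mfps_const_def one_mfps_def)

lemma mfps_const_0: "mfps_const 0 = 0"
  by (simp add: mfps_const_def zero_mfps_def)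

section \<open>Substitution into a univariate series\<close>

lemma mfps_nth_power_eq_0:
  assumes "mfps_nth g 0 = 0" "mi_size i < k"
  shows "mfps_nth (g ^ k) i = 0"
  using assms(2)
proof (induction k arbitrary: i)
  case (Suc k)
  have "mfps_nth g (fst p) * mfps_nth (g ^ k) (snd p) = 0" if "p \<in> mi_splits i" for p
  \<comment> \<open>A split with first exponent \<open>0\<close> is killed by the zero constant term
    of \<open>g\<close>. Any other split leaves a second exponent of strictly smaller degree, to
    which the induction hypothesis applies.\<close>
  proof (cases "fst p = 0")
    case False
    have "mi_size i = mi_size (fst p) + mi_size (snd p)"
      using that mi_size_add[of "fst p" "snd p"] by (auto simp: mi_splits_def)
    moreover have "mi_size (fst p) \<noteq> 0" using False by (simp add: mi_size_eq_0_iff)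
    ultimately show ?thesis using Suc by simp
  qed (simp add: assms(1))
  then show ?case by (simp add: mfps_nth_mult)
qed simp

text \<open>
  The truncation in \<^const>\<open>mfps_subst\<close> depends on the coefficient; truncating all coefficients at
  the same order gives an element of the ring generated by \<open>g\<close>.
\<close>

definition mfps_partial :: "'a::comm_ring_1 fps \<Rightarrow> ('v, 'a) mfps \<Rightarrow> nat \<Rightarrow> ('v, 'a) mfps" where
  "mfps_partial F g K = (\<Sum>k\<le>K. mfps_const (fps_nth F k) * g ^ k)"

lemma mfps_nth_subst:
  assumes "mfps_nth g 0 = 0" "mi_size i \<le> K"
  shows "mfps_nth (mfps_subst F g) i = mfps_nth (mfps_partial F g K) i"
proof -
  have "(\<Sum>k\<le>mi_size i. fps_nth F k * mfps_nth (g ^ k) i) =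
      (\<Sum>k\<le>K. fps_nth F k * mfps_nth (g ^ k) i)"
    using assms by (intro sum.mono_neutral_left) (auto simp: mfps_nth_power_eq_0)
  then show ?thesis by (simp add: mfps_subst_def mfps_partial_def)
qed

text \<open>The coefficient of a product at \<open>i\<close> uses only coefficients of the first
  factor of degree at most \<open>mi_size i\<close>, so a single cut-off \<open>K\<close> serves all
  of them.\<close>

lemma mfps_nth_subst_mult:
  assumes "mfps_nth g 0 = 0" "mi_size i \<le> K"
  shows "mfps_nth (mfps_subst F g * h) i = mfps_nth (mfps_partial F g K * h) i"
  unfolding mfps_nth_mult
proof (rule sum.cong)
  fix p assume "p \<in> mi_splits i"
  then have "mi_size (fst p) \<le> K"
    using assms(2) mi_size_add[of "fst p" "snd p"] by (auto simp: mi_splits_def)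
  then show "mfps_nth (mfps_subst F g) (fst p) * mfps_nth h (snd p) =
      mfps_nth (mfps_partial F g K) (fst p) * mfps_nth h (snd p)"
    using mfps_nth_subst[OF assms(1)] by metis
qed simp

lemma mfps_nth_subst_0 [simp]: "mfps_nth (mfps_subst F g) 0 = fps_nth F 0"
  by (simp add: mfps_subst_def mfps_nth_1)

lemma mfps_nth_exp_0 [simp]: "mfps_nth (mfps_exp g) 0 = 1"
  by (simp add: mfps_exp_def)

section \<open>The Euler derivation\<close>

definition euler_deriv :: "('v, 'a::comm_ring_1) mfps \<Rightarrow> ('v, 'a) mfps" where
  "euler_deriv f = Abs_mfps (\<lambda>i. of_nat (mi_size i) * mfps_nth f i)"

lemma mfps_nth_euler_deriv [simp]:
  "mfps_nth (euler_deriv f) i = of_nat (mi_size i) * mfps_nth f i"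
  by (simp add: euler_deriv_def)

lemma euler_deriv_0 [simp]: "euler_deriv 0 = 0"
  by (rule mfps_eqI) simp

lemma euler_deriv_1 [simp]: "euler_deriv 1 = 0"
  by (rule mfps_eqI) (simp add: mfps_nth_1)

lemma euler_deriv_add: "euler_deriv (f + g) = euler_deriv f + euler_deriv g"
  by (rule mfps_eqI) (simp add: algebra_simps)

lemma euler_deriv_diff: "euler_deriv (f - g) = euler_deriv f - euler_deriv g"
  by (rule mfps_eqI) (simp add: algebra_simps)

lemma euler_deriv_uminus: "euler_deriv (- f) = - euler_deriv f"
  by (rule mfps_eqI) simp

lemma euler_deriv_sum: "euler_deriv (sum f A) = (\<Sum>x\<in>A. euler_deriv (f x))"
  by (rule mfps_eqI) (simp add: sum_distrib_left)

lemma euler_deriv_const_mult: "euler_deriv (mfps_const c * f) = mfps_const c * euler_deriv f"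
  by (rule mfps_eqI) simp

lemma euler_deriv_var: "euler_deriv (mfps_var v) = mfps_var v"
  by (rule mfps_eqI) (simp add: mfps_var_def)

text \<open>Total degree is additive over each split of \<open>i\<close>, which is the Leibniz rule
  coefficient by coefficient.\<close>

lemma euler_deriv_mult: "euler_deriv (f * g) = euler_deriv f * g + f * euler_deriv g"
proof (rule mfps_eqI)
  fix i
  show "mfps_nth (euler_deriv (f * g)) i = mfps_nth (euler_deriv f * g + f * euler_deriv g) i"
    unfolding mfps_nth_add mfps_nth_euler_deriv mfps_nth_mult sum_distrib_left sum.distrib[symmetric]
    by (rule sum.cong) (auto simp: mi_splits_def mi_size_add algebra_simps)
qed

lemma euler_deriv_power: "euler_deriv (f ^ k) = of_nat k * f ^ (k - 1) * euler_deriv f"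
proof (induction k)
  case (Suc k)
  then show ?case
    by (cases k) (simp_all add: euler_deriv_mult algebra_simps)
qed simp

text \<open>The chain rule. Termwise differentiation is justified one coefficient at a time, where
  the substituted series is a finite sum of powers of \<open>g\<close>.\<close>

lemma euler_deriv_subst:
  fixes F :: "'a::comm_ring_1 fps"
  assumes "mfps_nth g 0 = 0"
  shows "euler_deriv (mfps_subst F g) = mfps_subst (fps_deriv F) g * euler_deriv g"
proof (rule mfps_eqI)
  fix i :: "'b \<Rightarrow>\<^sub>0 nat"
  let ?K = "mi_size i"
  \<comment> \<open>One power beyond \<open>mi_size i\<close> is kept before differentiating,
    because the derivative of \<open>g ^ k\<close> involves \<open>g ^ (k - 1)\<close>. After the
    index shift the sum runs exactly up to \<open>mi_size i\<close>.\<close>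
  have "mfps_nth (euler_deriv (mfps_subst F g)) i =
      mfps_nth (euler_deriv (mfps_partial F g (Suc ?K))) i"
    by (simp add: mfps_nth_subst[OF assms, of i "Suc ?K"])
  also have "euler_deriv (mfps_partial F g (Suc ?K)) =
      (\<Sum>k\<le>Suc ?K. mfps_const (fps_nth F k) * (of_nat k * g ^ (k - 1) * euler_deriv g))"
    by (simp only: mfps_partial_def euler_deriv_sum euler_deriv_const_mult euler_deriv_power)
  also have "\<dots> =
      (\<Sum>k\<le>?K. mfps_const (fps_nth F (Suc k)) * (of_nat (Suc k) * g ^ k * euler_deriv g))"
    by (subst sum.atMost_Suc_shift) simp
  also have "\<dots> = mfps_partial (fps_deriv F) g ?K * euler_deriv g"
    unfolding mfps_partial_def sum_distrib_right
  proof (rule sum.cong)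
    fix k
    show "mfps_const (fps_nth F (Suc k)) * (of_nat (Suc k) * g ^ k * euler_deriv g) =
        mfps_const (fps_nth (fps_deriv F) k) * g ^ k * euler_deriv g"
      by (rule mfps_eqI) (simp only: mult.assoc mfps_nth_const_mult mfps_nth_of_nat_mult fps_deriv_nth, simp)
  qed simp
  also have "mfps_nth \<dots> i = mfps_nth (mfps_subst (fps_deriv F) g * euler_deriv g) i"
    by (rule mfps_nth_subst_mult[OF assms order.refl, symmetric])
  finally show "mfps_nth (euler_deriv (mfps_subst F g)) i =
      mfps_nth (mfps_subst (fps_deriv F) g * euler_deriv g) i" .
qed

lemma euler_deriv_exp:
  assumes "mfps_nth g 0 = 0"
  shows "euler_deriv (mfps_exp g) = mfps_exp g * euler_deriv g"
  using euler_deriv_subst[OF assms, of "fps_exp 1"] by (simp add: mfps_exp_def)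

text \<open>The truncated geometric series in \<open>- g\<close> telescopes, and the remainder is a
  power of \<open>g\<close> too high to reach the coefficient considered. This supplies the
  reciprocal needed for the derivative of the logarithm.\<close>

lemma mfps_subst_inverse_1_plus_X:
  fixes g :: "('v, 'a::field_char_0) mfps"
  assumes "mfps_nth g 0 = 0"
  shows "mfps_subst (inverse (1 + fps_X)) g * (1 + g) = 1"
proof (rule mfps_eqI)
  fix i :: "'v \<Rightarrow>\<^sub>0 nat"
  let ?K = "mi_size i"
  have "mfps_const ((- 1) ^ k) * g ^ k = (- g) ^ k" for k
    by (rule mfps_eqI) (cases "even k"; simp)
  then have "mfps_partial (inverse (1 + fps_X)) g ?K = (\<Sum>k\<le>?K. (- g) ^ k)"
    by (simp add: mfps_partial_def fps_inverse_fps_X_plus1)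
  moreover have "(\<Sum>k\<le>K. (- g) ^ k) * (1 + g) = 1 - (- g) ^ Suc K" for K
    by (induction K) (simp_all add: algebra_simps)
  ultimately have "mfps_partial (inverse (1 + fps_X)) g ?K * (1 + g) = 1 - (- g) ^ Suc ?K"
    by simp
  moreover have "mfps_nth ((- g) ^ Suc ?K) i = 0"
    by (rule mfps_nth_power_eq_0) (simp_all add: assms)
  ultimately show "mfps_nth (mfps_subst (inverse (1 + fps_X)) g * (1 + g)) i = mfps_nth 1 i"
    by (simp only: mfps_nth_subst_mult[OF assms order.refl] mfps_nth_diff) simp
qed

text \<open>The chain rule turns the logarithm into the reciprocal of \<open>f\<close>, which
  cancels the factor \<open>f\<close> of the derivative. Giving the derivative as
  \<open>h * f\<close> keeps division out of the statement.\<close>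

lemma euler_deriv_ln:
  assumes "mfps_nth f 0 = 1" and "euler_deriv f = h * f"
  shows "euler_deriv (mfps_ln f) = h"
proof -
  have g: "mfps_nth (f - 1) 0 = 0" using assms(1) by (simp add: mfps_nth_1)
  let ?I = "mfps_subst (inverse (1 + fps_X)) (f - 1)"
  have "euler_deriv (mfps_ln f) = ?I * (h * f)"
    unfolding mfps_ln_def
    by (subst euler_deriv_subst[OF g])
      (simp add: fps_ln_deriv euler_deriv_diff assms(2))
  also have "\<dots> = h * (?I * (1 + (f - 1)))" by (simp add: algebra_simps)
  also have "\<dots> = h" using mfps_subst_inverse_1_plus_X[OF g] by simp
  finally show ?thesis .
qed

lemma mfps_inverse_eqI:
  fixes f g :: "('v, 'a::comm_ring_1) mfps"
  assumes "f * g = 1"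
  shows "inverse f = g"
proof -
  have "f dvd 1" by (rule dvdI) (rule assms[symmetric])
  moreover have "(THE g. f * g = 1) = g"
  proof (rule the_equality)
    show "f * g = 1" by (rule assms)
    fix h assume "f * h = 1"
    have "h = f * g * h" by (simp add: assms)
    also have "\<dots> = f * h * g" by (simp only: mult_ac)
    also have "\<dots> = g" by (simp add: \<open>f * h = 1\<close>)
    finally show "h = g" .
  qed
  ultimately show ?thesis by (simp add: inverse_mfps_def)
qed

section \<open>Derivations and determinants\<close>

text \<open>Each summand remains a product over all of \<open>A\<close> with one factor replaced, so
  that it can be read as a term of a determinant with one row replaced.\<close>

lemma derivation_prod:
  fixes D :: "'a::comm_ring_1 \<Rightarrow> 'a"
  assumes "\<And>a b. D (a * b) = D a * b + a * D b" and "finite A"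
  shows "D (\<Prod>x\<in>A. f x) = (\<Sum>x\<in>A. \<Prod>y\<in>A. if y = x then D (f y) else f y)"
  using assms(2)
proof (induction A)
  case empty
  \<comment> \<open>This reads \<open>D 1 = D 1 + D 1\<close>, hence \<open>D 1 = 0\<close>.\<close>
  have "D (1 * 1) = D 1 * 1 + 1 * D 1" by (rule assms(1))
  then show ?case by simp
next
  case (insert a A)
  have "(\<Prod>y\<in>A. if y = a then D (f y) else f y) = (\<Prod>y\<in>A. f y)"
    using insert by (intro prod.cong) auto
  moreover have "(\<Sum>x\<in>A. (if a = x then D (f a) else f a) *
      (\<Prod>y\<in>A. if y = x then D (f y) else f y)) =
      (\<Sum>x\<in>A. f a * (\<Prod>y\<in>A. if y = x then D (f y) else f y))"
    using insert by (intro sum.cong) auto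
  ultimately show ?case
    using insert by (simp add: assms(1) sum_distrib_left)
qed

text \<open>Jacobi's formula. By the Leibniz rule the derivative is a sum of determinants, each with
  one row \<open>r\<close> differentiated. That row is a combination of the rows
  \<open>N $ t\<close> with coefficients \<open>X $ r $ t\<close>, and every \<open>t\<close> other
  than \<open>r\<close> produces a repeated row.\<close>

lemma derivation_det:
  fixes D :: "'a::comm_ring_1 \<Rightarrow> 'a" and N X :: "'a^'n^'n"
  assumes add: "\<And>a b. D (a + b) = D a + D b"
    and mult: "\<And>a b. D (a * b) = D a * b + a * D b"
    and X: "map_matrix D N = X ** N"
  shows "D (det N) = trace X * det N"
proof -
  have D0: "D 0 = 0" using add[of 0 0] by simp
  have Duminus: "D (- a) = - D a" for a
    using add[of a "- a"] D0 by (simp add: eq_neg_iff_add_eq_0 add.commute)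
  have Dsum: "D (sum f A) = (\<Sum>x\<in>A. D (f x))" for f :: "('n \<Rightarrow> 'n) \<Rightarrow> 'a" and A
    by (induction A rule: infinite_finite_induct) (simp_all add: add D0)
  have Dsign: "D (of_int (sign p) * a) = of_int (sign p) * D a" for p :: "'n \<Rightarrow> 'n" and a
    by (simp add: sign_def Duminus)
  have "D (det N) = (\<Sum>p | p permutes UNIV. of_int (sign p) *
      (\<Sum>r\<in>UNIV. \<Prod>s\<in>UNIV. if s = r then D (N $ s $ p s) else N $ s $ p s))"
    unfolding det_def by (simp add: Dsum Dsign derivation_prod[OF mult])
  also have "\<dots> = (\<Sum>r\<in>UNIV. det (\<chi> s. if s = r then map_matrix D N $ s else N $ s))"
    unfolding det_def sum_distrib_left
    by (subst sum.swap) (intro sum.cong prod.cong refl arg_cong2[where f = "(*)"], simp)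
  also have "\<dots> = (\<Sum>r\<in>UNIV. X $ r $ r * det N)"
  proof (rule sum.cong[OF refl])
    fix r
    have row: "map_matrix D N $ s = (\<Sum>t\<in>UNIV. X $ s $ t *s N $ t)" for s
      by (simp add: X vec_eq_iff matrix_matrix_mult_def)
    have "det (\<chi> s. if s = r then map_matrix D N $ s else N $ s) =
        (\<Sum>t\<in>UNIV. X $ r $ t * det (\<chi> s. if s = r then N $ t else N $ s))"
    proof -
      have "(\<chi> s. if s = r then map_matrix D N $ s else N $ s) =
          (\<chi> s. if s = r then \<Sum>t\<in>UNIV. X $ r $ t *s N $ t else N $ s)"
        by (auto simp: vec_eq_iff row)
      then show ?thesis
        by (simp add: det_linear_row_sum det_row_mul)
    qed
    also have "\<dots> = (\<Sum>t\<in>UNIV. if t = r then X $ r $ r * det N else 0)"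
    proof (rule sum.cong[OF refl])
      fix t
      show "X $ r $ t * det (\<chi> s. if s = r then N $ t else N $ s) =
          (if t = r then X $ r $ r * det N else 0)"
      proof (cases "t = r")
        case True
        then have "(\<chi> s. if s = r then N $ t else N $ s) = N"
          by (auto simp: vec_eq_iff)
        then show ?thesis using True by simp
      next
        case False
        then have "det (\<chi> s. if s = r then N $ t else N $ s) = 0"
          by (intro det_identical_rows[of t r]) (auto simp: row_def)
        then show ?thesis using False by simp
      qed
    qed
    also have "\<dots> = X $ r $ r * det N" by simp
    finally show "det (\<chi> s. if s = r then map_matrix D N $ s else N $ s) = X $ r $ r * det N" .
  qed
  also have "\<dots> = trace X * det N" by (simp add: trace_def sum_distrib_right)
  finally show ?thesis .
qed

section \<open>Words and the geometric series of a matrix\<close>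

text \<open>The Parikh vector of \<open>w\<close>: the exponent of the monomial formed by
  multiplying the variables of its letters.\<close>

definition word_kind :: "'v list \<Rightarrow> ('v \<Rightarrow>\<^sub>0 nat)" where
  "word_kind w = (\<Sum>k\<leftarrow>w. Poly_Mapping.single k 1)"

lemma word_kind_simps [simp]:
  "word_kind [] = 0" "word_kind (k # w) = Poly_Mapping.single k 1 + word_kind w"
  by (simp_all add: word_kind_def)

lemma mi_size_word_kind: "mi_size (word_kind w) = length w"
  by (induction w) (simp_all add: mi_size_add)

lemma lookup_word_kind: "Poly_Mapping.lookup (word_kind w) v = count_list w v"
  by (induction w) (auto simp: lookup_add lookup_single when_def)

definition words_of_kind :: "nat \<Rightarrow> (nat \<Rightarrow>\<^sub>0 nat) \<Rightarrow> nat list set" where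
  "words_of_kind m i = {w. set w \<subseteq> {1..m} \<and> word_kind w = i}"

lemma finite_words_of_kind [simp]: "finite (words_of_kind m i)"
proof (rule finite_subset)
  show "words_of_kind m i \<subseteq> {w. set w \<subseteq> {1..m} \<and> length w = mi_size i}"
    by (auto simp: words_of_kind_def mi_size_word_kind)
qed (rule finite_lists_length_eq, simp)

text \<open>The image of the noncommutative generating series of \<open>c\<close> when the variables
  are made to commute. Decompositions of words thereby become identities of power series.\<close>

definition word_series :: "nat \<Rightarrow> (nat list \<Rightarrow> 'a::comm_ring_1) \<Rightarrow> (nat, 'a) mfps" where
  "word_series m c = Abs_mfps (\<lambda>i. \<Sum>w\<in>words_of_kind m i. c w)"

lemma mfps_nth_word_series [simp]:
  "mfps_nth (word_series m c) i = (\<Sum>w\<in>words_of_kind m i. c w)"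
  by (simp add: word_series_def)

lemma mfps_nth_var_mult:
  "mfps_nth (mfps_var v * f) i =
    (\<Sum>p\<in>mi_splits i. if fst p = Poly_Mapping.single v 1 then mfps_nth f (snd p) else 0)"
  unfolding mfps_nth_mult mfps_var_def by (intro sum.cong) auto

lemma mfps_nth_var_mult_word_series:
  "mfps_nth (mfps_var k * word_series m c) i =
    (\<Sum>w | set w \<subseteq> {1..m} \<and> word_kind (k # w) = i. c w)"
\<comment> \<open>If the variable divides the monomial of \<open>i\<close>, exactly one split
  contributes; otherwise both sides are empty sums.\<close>
proof (cases "\<exists>j. i = Poly_Mapping.single k 1 + j")
  case True
  then obtain j where j: "i = Poly_Mapping.single k 1 + j" by blast
  have "mfps_nth (mfps_var k * word_series m c) i =
      (\<Sum>p\<in>mi_splits i. if p = (Poly_Mapping.single k 1, j)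
        then mfps_nth (word_series m c) j else 0)"
    unfolding mfps_nth_var_mult by (rule sum.cong) (auto simp: mi_splits_def j)
  also have "\<dots> = mfps_nth (word_series m c) j"
  proof -
    have "(Poly_Mapping.single k 1, j) \<in> mi_splits i" by (simp add: mi_splits_def j)
    then show ?thesis by simp
  qed
  finally show ?thesis by (simp add: words_of_kind_def j)
next
  case False
  then have "{w. set w \<subseteq> {1..m} \<and> word_kind (k # w) = i} = {}" by auto
  moreover have "fst p \<noteq> Poly_Mapping.single k 1" if "p \<in> mi_splits i" for p
    using that False by (auto simp: mi_splits_def)
  ultimately show ?thesis by (simp only: mfps_nth_var_mult) simp
qed

lemma sum_const_mult_word_series:
  "(\<Sum>t\<in>T. mfps_const (a t) * word_series m (c t)) = word_series m (\<lambda>w. \<Sum>t\<in>T. a t * c t w)"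
  by (rule mfps_eqI) (simp add: sum_distrib_left, rule sum.swap)

text \<open>Nonempty words are sorted by their first letter. Applied to entries of matrix products,
  this becomes the equation N = I + A N.\<close>

lemma word_series_Cons:
  "word_series m c = mfps_const (c []) + (\<Sum>k=1..m. mfps_var k * word_series m (\<lambda>w. c (k # w)))"
proof (rule mfps_eqI)
  fix i
  let ?W = "\<lambda>k. {w. set w \<subseteq> {1..m} \<and> word_kind (k # w) = i}"
  let ?E = "{w. w = [] \<and> i = 0}"
  have fin: "finite (?W k)" if "k \<in> {1..m}" for k
  proof (rule finite_surj)
    show "?W k \<subseteq> tl ` words_of_kind m i"
    proof
      fix w assume "w \<in> ?W k"
      then have "k # w \<in> words_of_kind m i" using that by (auto simp: words_of_kind_def)
      then show "w \<in> tl ` words_of_kind m i" by force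
    qed
  qed simp
  have split: "words_of_kind m i = ?E \<union> (\<Union>k\<in>{1..m}. (#) k ` ?W k)"
  proof (intro equalityI subsetI)
    fix w assume "w \<in> words_of_kind m i"
    then show "w \<in> ?E \<union> (\<Union>k\<in>{1..m}. (#) k ` ?W k)"
      by (cases w) (auto simp: words_of_kind_def)
  qed (auto simp: words_of_kind_def)
  have "(\<Sum>w\<in>words_of_kind m i. c w) =
      (\<Sum>w\<in>?E. c w) + (\<Sum>w\<in>(\<Union>k\<in>{1..m}. (#) k ` ?W k). c w)"
    unfolding split using fin by (intro sum.union_disjoint) auto
  also have "(\<Sum>w\<in>(\<Union>k\<in>{1..m}. (#) k ` ?W k). c w) = (\<Sum>k=1..m. \<Sum>w\<in>(#) k ` ?W k. c w)"
    using fin by (intro sum.UNION_disjoint) auto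
  also have "\<dots> = (\<Sum>k=1..m. \<Sum>w\<in>?W k. c (k # w))"
    by (simp add: sum.reindex inj_on_def comp_def)
  also have "(\<Sum>w\<in>?E. c w) = mfps_nth (mfps_const (c [])) i"
    by (simp add: mfps_const_def)
  finally show "mfps_nth (word_series m c) i = mfps_nth (mfps_const (c []) +
      (\<Sum>k=1..m. mfps_var k * word_series m (\<lambda>w. c (k # w)))) i"
    by (simp only: mfps_nth_word_series mfps_nth_add mfps_nth_sum mfps_nth_var_mult_word_series)
qed

text \<open>Reversal preserves the kind of a word. This transfers the decomposition by first letter
  to one by last letter, which yields N = I + N A.\<close>

lemma word_series_rev: "word_series m (\<lambda>w. c (rev w)) = word_series m c"
proof (rule mfps_eqI)
  fix i
  have "word_kind (rev w) = word_kind w" for w :: "nat list"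
    by (rule poly_mapping_eqI) (simp add: lookup_word_kind)
  then show "mfps_nth (word_series m (\<lambda>w. c (rev w))) i = mfps_nth (word_series m c) i"
    unfolding mfps_nth_word_series
    by (intro sum.reindex_bij_witness[where i = rev and j = rev]) (auto simp: words_of_kind_def)
qed

lemma word_series_snoc:
  "word_series m c = mfps_const (c []) + (\<Sum>k=1..m. mfps_var k * word_series m (\<lambda>w. c (w @ [k])))"
proof -
  have "word_series m c = word_series m (\<lambda>w. c (rev w))" by (rule word_series_rev[symmetric])
  also have "\<dots> = mfps_const (c []) +
      (\<Sum>k=1..m. mfps_var k * word_series m (\<lambda>w. c (rev w @ [k])))"
    by (subst word_series_Cons) simp
  also have "\<dots> = mfps_const (c []) +
      (\<Sum>k=1..m. mfps_var k * word_series m (\<lambda>w. c (w @ [k])))"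
    by (simp only: word_series_rev[of m "\<lambda>w. c (w @ [k])" for k])
  finally show ?thesis .
qed

section \<open>Matrix products along words\<close>

lemma string_prod_Nil [simp]: "string_prod A [] = mat 1"
  by (simp add: string_prod_def)

lemma string_prod_Cons [simp]: "string_prod A (k # w) = A k ** string_prod A w"
  by (simp add: string_prod_def)

lemma string_prod_append: "string_prod A (u @ v) = string_prod A u ** string_prod A v"
  by (induction u) (simp_all add: matrix_mul_assoc)

lemma string_prod_snoc: "string_prod A (w @ [k]) = string_prod A w ** A k"
  by (simp add: string_prod_append)

lemma matrix_mult_diff_left: "(A - B) ** (C :: 'a::comm_ring_1^'n^'m) = A ** C - B ** C"
  by (simp add: vec_eq_iff matrix_matrix_mult_def algebra_simps sum_subtractf)

lemma matrix_mult_diff_right: "(C :: 'a::comm_ring_1^'n^'m) ** (A - B) = C ** A - C ** B"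
  by (simp add: vec_eq_iff matrix_matrix_mult_def algebra_simps sum_subtractf)

text \<open>\<open>matrix_inv\<close> is a choice among two-sided inverses, and associativity leaves
  only one candidate.\<close>

lemma matrix_inv_eqI:
  assumes "A ** B = mat 1" "B ** A = mat 1"
  shows "matrix_inv A = B"
proof -
  have "A ** matrix_inv A = mat 1 \<and> matrix_inv A ** A = mat 1"
    unfolding matrix_inv_def by (rule someI[where x = B]) (use assms in simp)
  then have "matrix_inv A = matrix_inv A ** (A ** B)" "matrix_inv A ** A = mat 1"
    by (simp_all add: assms)
  then show ?thesis by (simp add: matrix_mul_assoc)
qed

lemma euler_deriv_matrix_mult:
  "map_matrix euler_deriv (A ** B) = map_matrix euler_deriv A ** B + A ** map_matrix euler_deriv B"
  by (simp add: vec_eq_iff matrix_matrix_mult_def euler_deriv_sum euler_deriv_mult sum.distrib)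

text \<open>The geometric series $\sum_k (\sum_v B_v z_v)^k$, expanded into words.\<close>

definition word_matrix :: "nat \<Rightarrow> (nat \<Rightarrow> complex^'p^'p) \<Rightarrow> ((nat, complex) mfps)^'p^'p" where
  "word_matrix m B = (\<chi> r s. word_series m (\<lambda>w. string_prod B w $ r $ s))"

lemma const_matrix_mult_var_matrix:
  "const_matrix S ** var_matrix m H = var_matrix m (\<lambda>k. S ** H k)"
proof -
  have "mfps_nth (\<Sum>t\<in>UNIV. mfps_const (S $ r $ t) *
      (\<Sum>k=1..m. mfps_const (H k $ t $ s) * mfps_var k)) i =
    mfps_nth (\<Sum>k=1..m. mfps_const (\<Sum>t\<in>UNIV. S $ r $ t * H k $ t $ s) * mfps_var k) i"
    for r s i
    by (simp add: sum_distrib_left sum_distrib_right mult.assoc) (rule sum.swap)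
  then show ?thesis
    by (simp add: vec_eq_iff matrix_matrix_mult_def const_matrix_def var_matrix_def mfps_eqI)
qed

lemma var_matrix_nth:
  "var_matrix m B $ r $ s = (\<Sum>k=1..m. mfps_const (B k $ r $ s) * mfps_var k)"
  by (simp add: var_matrix_def)

lemma var_matrix_mult_word_matrix: "var_matrix m B ** word_matrix m B = word_matrix m B - mat 1"
proof -
  have "(\<Sum>t\<in>UNIV. (\<Sum>k=1..m. mfps_const (B k $ r $ t) * mfps_var k) *
      word_series m (\<lambda>w. string_prod B w $ t $ s)) =
    word_series m (\<lambda>w. string_prod B w $ r $ s) - mat 1 $ r $ s" for r s
  proof -
    have "(\<Sum>t\<in>UNIV. (\<Sum>k=1..m. mfps_const (B k $ r $ t) * mfps_var k) *
        word_series m (\<lambda>w. string_prod B w $ t $ s)) =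
      (\<Sum>k=1..m. mfps_var k * (\<Sum>t\<in>UNIV. mfps_const (B k $ r $ t) *
        word_series m (\<lambda>w. string_prod B w $ t $ s)))"
      unfolding sum_distrib_left sum_distrib_right by (subst sum.swap) (simp only: mult_ac)
    also have "\<dots> = (\<Sum>k=1..m. mfps_var k *
        word_series m (\<lambda>w. string_prod B (k # w) $ r $ s))"
      by (simp add: sum_const_mult_word_series matrix_matrix_mult_def)
    also have "\<dots> = word_series m (\<lambda>w. string_prod B w $ r $ s) -
        mfps_const (string_prod B [] $ r $ s)"
      by (subst word_series_Cons[of m "\<lambda>w. string_prod B w $ r $ s"]) simp
    also have "mfps_const (string_prod B [] $ r $ s) = mat 1 $ r $ s"
      by (simp add: mat_def mfps_const_0 mfps_const_1)
    finally show ?thesis .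
  qed
  then show ?thesis
    by (simp add: vec_eq_iff matrix_matrix_mult_def var_matrix_nth word_matrix_def)
qed

lemma word_matrix_mult_var_matrix: "word_matrix m B ** var_matrix m B = word_matrix m B - mat 1"
proof -
  have "(\<Sum>t\<in>UNIV. word_series m (\<lambda>w. string_prod B w $ r $ t) *
      (\<Sum>k=1..m. mfps_const (B k $ t $ s) * mfps_var k)) =
    word_series m (\<lambda>w. string_prod B w $ r $ s) - mat 1 $ r $ s" for r s
  proof -
    have "(\<Sum>t\<in>UNIV. word_series m (\<lambda>w. string_prod B w $ r $ t) *
        (\<Sum>k=1..m. mfps_const (B k $ t $ s) * mfps_var k)) =
      (\<Sum>k=1..m. mfps_var k * (\<Sum>t\<in>UNIV. mfps_const (B k $ t $ s) *
        word_series m (\<lambda>w. string_prod B w $ r $ t)))"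
      unfolding sum_distrib_left sum_distrib_right by (subst sum.swap) (simp only: mult_ac)
    also have "\<dots> = (\<Sum>k=1..m. mfps_var k *
        word_series m (\<lambda>w. string_prod B (w @ [k]) $ r $ s))"
      by (simp add: sum_const_mult_word_series string_prod_snoc matrix_matrix_mult_def mult.commute)
    also have "\<dots> = word_series m (\<lambda>w. string_prod B w $ r $ s) -
        mfps_const (string_prod B [] $ r $ s)"
      by (subst word_series_snoc[of m "\<lambda>w. string_prod B w $ r $ s"]) simp
    also have "mfps_const (string_prod B [] $ r $ s) = mat 1 $ r $ s"
      by (simp add: mat_def mfps_const_0 mfps_const_1)
    finally show ?thesis .
  qed
  then show ?thesis
    by (simp add: vec_eq_iff matrix_matrix_mult_def var_matrix_nth word_matrix_def)
qed

lemma word_matrix_inverse: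
  "(mat 1 - var_matrix m B) ** word_matrix m B = mat 1"
  "word_matrix m B ** (mat 1 - var_matrix m B) = mat 1"
  by (simp_all add: matrix_mult_diff_left matrix_mult_diff_right
      var_matrix_mult_word_matrix word_matrix_mult_var_matrix)

lemma euler_deriv_var_matrix: "map_matrix euler_deriv (var_matrix m B) = var_matrix m B"
  by (simp add: vec_eq_iff var_matrix_nth euler_deriv_sum euler_deriv_const_mult euler_deriv_var)

text \<open>Differentiating N - I = N A with D A = A gives D N (I - A) = N A, and multiplication by
  N on the right isolates D N. The result is grouped as a matrix times N, as
  \<open>derivation_det\<close> requires.\<close>

lemma euler_deriv_word_matrix:
  "map_matrix euler_deriv (word_matrix m B) =
    (word_matrix m B ** var_matrix m B) ** word_matrix m B"
proof -
  let ?N = "word_matrix m B" and ?A = "var_matrix m B" and ?D = "map_matrix euler_deriv"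
  have "?D ?N = ?D (?N - mat 1)"
    by (simp add: vec_eq_iff euler_deriv_diff mat_def)
  also have "\<dots> = ?D ?N ** ?A + ?N ** ?A"
    by (simp add: word_matrix_mult_var_matrix[symmetric] euler_deriv_matrix_mult
        euler_deriv_var_matrix)
  finally have "?D ?N ** (mat 1 - ?A) = ?N ** ?A"
    by (simp add: matrix_mult_diff_right diff_eq_eq add.commute)
  then have "(?D ?N ** (mat 1 - ?A)) ** ?N = (?N ** ?A) ** ?N" by simp
  then show ?thesis
    by (simp add: matrix_mul_assoc[symmetric] word_matrix_inverse)
qed

lemma euler_deriv_det_word_matrix:
  "euler_deriv (det (word_matrix m B)) = trace (word_matrix m B - mat 1) * det (word_matrix m B)"
  using derivation_det[OF euler_deriv_add euler_deriv_mult euler_deriv_word_matrix, of m B]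
  by (simp add: word_matrix_mult_var_matrix)

lemma word_matrix_minus_1_nth:
  assumes "i \<noteq> 0"
  shows "mfps_nth ((word_matrix m B - mat 1) $ r $ s) i =
    (\<Sum>w\<in>words_of_kind m i. string_prod B w $ r $ s)"
  using assms by (simp add: word_matrix_def mat_def mfps_nth_1)

text \<open>The empty word is the only word of kind \<open>0\<close>, and its product is the
  identity. Hence the exponent of the generating function has zero constant term and its determinant
  has constant term \<open>1\<close>.\<close>

lemma word_matrix_minus_1_nth_0: "mfps_nth ((word_matrix m B - mat 1) $ r $ s) 0 = 0"
proof -
  have "w = []" if "word_kind w = 0" for w :: "nat list"
    using mi_size_word_kind[of w] that by simp
  then have "words_of_kind m 0 = {[]}" by (auto simp: words_of_kind_def)
  then show ?thesis by (simp add: word_matrix_def mat_def mfps_nth_1)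
qed

lemma mfps_nth_trace_word_matrix:
  assumes "i \<noteq> 0"
  shows "mfps_nth (trace (word_matrix m B - mat 1)) i =
    (\<Sum>w\<in>words_of_kind m i. trace (string_prod B w))"
  unfolding trace_def mfps_nth_sum word_matrix_minus_1_nth[OF assms] by (rule sum.swap)

lemma mfps_nth_trace_const_word_matrix:
  assumes "i \<noteq> 0"
  shows "mfps_nth (trace (const_matrix C ** (word_matrix m B - mat 1))) i =
    (\<Sum>w\<in>words_of_kind m i. trace (C ** string_prod B w))"
proof -
  have "mfps_nth (trace (const_matrix C ** (word_matrix m B - mat 1))) i =
      (\<Sum>r\<in>UNIV. \<Sum>t\<in>UNIV. C $ r $ t * mfps_nth ((word_matrix m B - mat 1) $ t $ r) i)"
    by (simp add: trace_def matrix_matrix_mult_def const_matrix_def del: vector_minus_component)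
  also have "\<dots> = (\<Sum>r\<in>UNIV. \<Sum>t\<in>UNIV. \<Sum>w\<in>words_of_kind m i.
      C $ r $ t * string_prod B w $ t $ r)"
    by (simp only: word_matrix_minus_1_nth[OF assms] sum_distrib_left)
  also have "\<dots> = (\<Sum>r\<in>UNIV. \<Sum>w\<in>words_of_kind m i. \<Sum>t\<in>UNIV.
      C $ r $ t * string_prod B w $ t $ r)"
    by (intro sum.cong refl sum.swap)
  also have "\<dots> = (\<Sum>w\<in>words_of_kind m i. trace (C ** string_prod B w))"
    by (subst sum.swap) (simp add: trace_def matrix_matrix_mult_def)
  finally show ?thesis .
qed

lemma mfps_nth_0_trace_const_word_matrix:
  "mfps_nth (trace (const_matrix C ** (word_matrix m B - mat 1))) 0 = 0"
  by (simp add: trace_def matrix_matrix_mult_def word_matrix_minus_1_nth_0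
      del: vector_minus_component)

lemma mfps_nth_prod_0: "mfps_nth (prod f A) 0 = (\<Prod>x\<in>A. mfps_nth (f x) 0)"
  by (induction A rule: infinite_finite_induct) (simp_all add: mfps_nth_1)

lemma mfps_nth_of_int_0: "mfps_nth (of_int z) 0 = of_int z"
proof (cases z)
  case (nonneg n)
  have "mfps_nth (of_nat n) 0 = of_nat n" by (induction n) (simp_all add: mfps_nth_1)
  then show ?thesis by (simp add: nonneg)
next
  case (neg n)
  have "mfps_nth (of_nat n) 0 = of_nat n" for n by (induction n) (simp_all add: mfps_nth_1)
  from this[of "Suc n"] show ?thesis by (simp add: neg del: of_nat_Suc)
qed

text \<open>Taking the constant term is a ring homomorphism, so it commutes with the
  determinant.\<close>

lemma mfps_nth_det_0: "mfps_nth (det A) 0 = det (map_matrix (\<lambda>f. mfps_nth f 0) A)"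
  by (simp add: det_def mfps_nth_prod_0 mfps_nth_of_int_0)

lemma mfps_nth_det_word_matrix_0: "mfps_nth (det (word_matrix m B)) 0 = 1"
proof -
  have "map_matrix (\<lambda>f. mfps_nth f 0) (word_matrix m B) = mat 1"
    using word_matrix_minus_1_nth_0[of m B]
    by (simp add: vec_eq_iff mat_def mfps_nth_1)
  then show ?thesis by (simp add: mfps_nth_det_0)
qed

section \<open>The moment generating function and its logarithm\<close>

lemma wishart_mgf_eq:
  fixes m :: nat and S Om :: "complex^'p^'p" and H :: "nat \<Rightarrow> complex^'p^'p"
  defines "N \<equiv> word_matrix m (\<lambda>k. S ** H k)"
  shows "wishart_mgf n S Om m H =
    mfps_exp (- trace (const_matrix Om ** (N - mat 1))) * det N ^ n"
proof -
  let ?A = "var_matrix m (\<lambda>k. S ** H k)"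
  have inv: "matrix_inv (mat 1 - ?A) = N"
    by (rule matrix_inv_eqI) (simp_all add: N_def word_matrix_inverse)
  \<comment> \<open>Cyclicity of the trace brings N next to A, where the product A N collapses to N
    - I.\<close>
  have "trace (N ** const_matrix Om ** ?A) = trace (const_matrix Om ** (?A ** N))"
    by (simp add: matrix_mul_assoc[symmetric] trace_mul_sym[of N])
  also have "?A ** N = N - mat 1" by (simp add: N_def var_matrix_mult_word_matrix)
  finally have tr: "trace (N ** const_matrix Om ** ?A) =
    trace (const_matrix Om ** (N - mat 1))" .
  have "det (mat 1 - ?A) * det N = 1"
    unfolding det_mul[symmetric] by (simp add: N_def word_matrix_inverse)
  then have "det (mat 1 - ?A) ^ n * det N ^ n = 1"
    by (simp add: power_mult_distrib[symmetric])
  then have "inverse (det (mat 1 - ?A) ^ n) = det N ^ n" by (rule mfps_inverse_eqI)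
  then show ?thesis
    by (simp add: wishart_mgf_def Let_def const_matrix_mult_var_matrix inv tr divide_mfps_def)
qed

text \<open>The determinant contributes the trace of N - I undifferentiated, whereas the exponent
  contributes a derivative. So the factor \<open>mi_size i\<close> appears on the left and in the
  \<open>Om\<close> term only, which is why the rho moments carry weights and the eta moments do
  not.\<close>

lemma mfps_ln_wishart_mgf:
  assumes "i \<noteq> 0"
  shows "of_nat (mi_size i) * mfps_nth (mfps_ln (wishart_mgf n S Om m H)) i =
    of_nat n * (\<Sum>w\<in>words_of_kind m i. trace (string_prod (\<lambda>k. S ** H k) w)) -
    of_nat (mi_size i) *
      (\<Sum>w\<in>words_of_kind m i. trace (Om ** string_prod (\<lambda>k. S ** H k) w))"
proof -
  let ?N = "word_matrix m (\<lambda>k. S ** H k)"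
  let ?T = "trace (const_matrix Om ** (?N - mat 1))"
  let ?d = "det ?N"
  let ?G = "wishart_mgf n S Om m H"
  have T0: "mfps_nth (- ?T) 0 = 0" by (simp add: mfps_nth_0_trace_const_word_matrix)
  have "euler_deriv (?d ^ n) = of_nat n * trace (?N - mat 1) * ?d ^ n"
    unfolding euler_deriv_power euler_deriv_det_word_matrix
    by (cases n) (simp_all add: mult_ac del: of_nat_Suc)
  then have "euler_deriv ?G = (of_nat n * trace (?N - mat 1) - euler_deriv ?T) * ?G"
    by (simp add: wishart_mgf_eq euler_deriv_mult euler_deriv_exp[OF T0] euler_deriv_uminus
        algebra_simps)
  moreover have "mfps_nth ?G 0 = 1"
    by (simp add: wishart_mgf_eq mfps_nth_det_word_matrix_0)
  ultimately have
    "euler_deriv (mfps_ln ?G) = of_nat n * trace (?N - mat 1) - euler_deriv ?T"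
    by (intro euler_deriv_ln)
  from arg_cong[OF this, of "\<lambda>f. mfps_nth f i"] show ?thesis
    by (simp add: mfps_nth_trace_word_matrix[OF assms] mfps_nth_trace_const_word_matrix[OF assms])
qed

section \<open>Grouping words into necklaces\<close>

lemma trace_string_prod_rotate: "trace (string_prod A (rotate k w)) = trace (string_prod A w)"
proof (induction k)
  case (Suc k)
  have "trace (string_prod A (rotate1 v)) = trace (string_prod A v)" for v
    by (cases v) (simp, simp add: string_prod_snoc, rule trace_mul_sym)
  then show ?case using Suc by simp
qed simp

lemma equiv_rotation_rel: "equiv UNIV rotation_rel"
proof (rule equivI)
  show "rotation_rel \<subseteq> UNIV \<times> UNIV" by simp
  show "refl rotation_rel"
    unfolding refl_on_def rotation_rel_def by (auto intro: exI[of _ 0])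
  show "sym rotation_rel"
  proof (rule symI)
    fix s t assume "(s, t) \<in> rotation_rel"
    then obtain k where t: "t = rotate k s" by (auto simp: rotation_rel_def)
    \<comment> \<open>The rotation by \<open>k\<close> is undone by completing
      \<open>k mod length s\<close> to a full turn; the empty word is treated apart because its
      length is no modulus.\<close>
    have "rotate (length s - k mod length s + k) s = s"
    proof (cases "s = []")
      case False
      then have le: "k mod length s \<le> length s" by (simp add: less_imp_le)
      have "(length s - k mod length s + k) mod length s =
          (length s - k mod length s + k mod length s) mod length s"
        by (simp only: mod_add_right_eq)
      also have "\<dots> = 0" using le by simp
      finally show ?thesis by (rule rotate_id)
    qed simp
    then have "s = rotate (length s - k mod length s) t" by (simp add: t rotate_rotate)
    then show "(t, s) \<in> rotation_rel" by (auto simp: rotation_rel_def)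
  qed
  show "trans rotation_rel"
    by (rule transI) (auto simp: rotation_rel_def rotate_rotate)
qed

lemma mem_necklace_iff: "t \<in> necklace s \<longleftrightarrow> (\<exists>k. t = rotate k s)"
  by (simp add: necklace_def rotation_rel_def)

lemma necklace_self: "s \<in> necklace s"
  unfolding necklace_def by (rule equiv_class_self[OF equiv_rotation_rel]) simp

lemma necklace_eq: "t \<in> necklace s \<Longrightarrow> necklace t = necklace s"
  unfolding necklace_def by (metis Image_singleton_iff equiv_class_eq[OF equiv_rotation_rel])

lemma finite_necklace: "finite (necklace s)"
proof (rule finite_subset)
  show "necklace s \<subseteq> {t. set t \<subseteq> set s \<and> length t = length s}"
    by (auto simp: mem_necklace_iff)
qed (rule finite_lists_length_eq, simp)

lemma Min_necklace_mem: "Min (necklace s) \<in> necklace s"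
  using finite_necklace necklace_self by (intro Min_in) auto

lemma necklace_Min: "necklace (Min (necklace s)) = necklace s"
  by (rule necklace_eq[OF Min_necklace_mem])

lemma word_kind_rotate: "word_kind (rotate k w) = word_kind w"
proof (induction k)
  case (Suc k)
  have "word_kind (rotate1 v) = word_kind v" for v :: "'a list"
    by (cases v) (simp_all add: word_kind_def add.commute)
  then show ?case using Suc by simp
qed simp

lemma necklace_subset_words_of_kind: "s \<in> words_of_kind m i \<Longrightarrow> necklace s \<subseteq> words_of_kind m i"
  by (auto simp: mem_necklace_iff words_of_kind_def word_kind_rotate subset_iff)

section \<open>Necklaces of a fixed kind\<close>

context
  fixes m :: nat and i :: "nat \<Rightarrow>\<^sub>0 nat"
  assumes keys: "Poly_Mapping.keys i \<subseteq> {1..m}"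
begin

lemma words_of_kind_conv:
  "words_of_kind m i =
    {s \<in> strings m (mi_size i). \<forall>j\<in>{1..m}. count_list s j = Poly_Mapping.lookup i j}"
proof (intro equalityI subsetI)
  fix s assume s: "s \<in> {s \<in> strings m (mi_size i). \<forall>j\<in>{1..m}. count_list s j = Poly_Mapping.lookup i j}"
  have "count_list s j = Poly_Mapping.lookup i j" for j
  proof (cases "j \<in> {1..m}")
    \<comment> \<open>Such a letter does not occur in \<open>s\<close>, and by \<open>keys\<close>
      its exponent in \<open>i\<close> vanishes as well.\<close>
    case False
    then have "j \<notin> set s" "j \<notin> Poly_Mapping.keys i" using s keys by (auto simp: strings_def)
    then show ?thesis by (simp add: in_keys_iff)
  qed (use s in simp)
  then have "word_kind s = i"
    by (intro poly_mapping_eqI) (simp add: lookup_word_kind)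
  then show "s \<in> words_of_kind m i" using s by (simp add: words_of_kind_def strings_def)
qed (auto simp: words_of_kind_def strings_def mi_size_word_kind lookup_word_kind)

text \<open>The letter counts are prescribed for every string of the class, but rotation preserves
  the kind, so one string decides.\<close>

lemma necklaces_of_kind_eq: "necklaces_of_kind m i = necklace ` words_of_kind m i"
proof (intro equalityI subsetI)
  fix A assume "A \<in> necklaces_of_kind m i"
  then obtain s where "s \<in> strings m (mi_size i)" "A = necklace s"
    and "\<forall>t\<in>A. \<forall>j\<in>{1..m}. count_list t j = Poly_Mapping.lookup i j"
    by (auto simp: necklaces_of_kind_def necklaces_def quotient_def necklace_def)
  then show "A \<in> necklace ` words_of_kind m i"
    using necklace_self[of s] by (auto simp: words_of_kind_conv)
next
  fix A assume "A \<in> necklace ` words_of_kind m i"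
  then obtain s where s: "s \<in> words_of_kind m i" and A: "A = necklace s" by blast
  have "A \<in> necklaces m (mi_size i)"
    using s unfolding A necklaces_def necklace_def words_of_kind_conv
    by (intro quotientI) simp
  moreover have "A \<subseteq> words_of_kind m i"
    using necklace_subset_words_of_kind[OF s] by (simp add: A)
  ultimately show "A \<in> necklaces_of_kind m i"
    by (auto simp: necklaces_of_kind_def words_of_kind_conv)
qed

lemma necklace_reps_eq: "necklace_reps m i = (\<lambda>s. Min (necklace s)) ` words_of_kind m i"
  by (simp add: necklace_reps_def necklaces_of_kind_eq image_image)

lemma finite_necklace_reps: "finite (necklace_reps m i)"
  by (simp add: necklace_reps_eq)

lemma Min_necklace_rep: "a \<in> necklace_reps m i \<Longrightarrow> Min (necklace a) = a"
  by (auto simp: necklace_reps_eq necklace_Min)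

text \<open>The class can be recovered from its minimum by \<open>necklace_Min\<close>, so its
  cardinality is a property of the representative.\<close>

lemma aperiodic_necklace_reps_eq:
  "aperiodic_necklace_reps m i = {a \<in> necklace_reps m i. necklace_period a = mi_size i}"
  by (auto simp: aperiodic_necklace_reps_def necklace_reps_def necklaces_of_kind_eq
      necklace_period_def necklace_Min image_iff)

text \<open>The necklaces partition the words of kind \<open>i\<close>. Distinct representatives
  have disjoint classes, since equal classes would have the same minimum.\<close>

lemma sum_necklace_reps:
  "(\<Sum>a\<in>necklace_reps m i. \<Sum>b\<in>necklace a. f b) = (\<Sum>w\<in>words_of_kind m i. f w)"
proof -
  have "(\<Union>a\<in>necklace_reps m i. necklace a) = words_of_kind m i"
    using necklace_self necklace_subset_words_of_kind
    by (fastforce simp: necklace_reps_eq necklace_Min)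
  moreover have "necklace a \<inter> necklace b = {}"
    if "a \<in> necklace_reps m i" "b \<in> necklace_reps m i" "a \<noteq> b" for a b
  proof (rule ccontr)
    assume "necklace a \<inter> necklace b \<noteq> {}"
    then have "necklace a = necklace b" using necklace_eq by blast
    then show False using that Min_necklace_rep by metis
  qed
  ultimately show ?thesis
    by (subst sum.UNION_disjoint[symmetric]) (simp_all add: finite_necklace_reps finite_necklace)
qed

lemma eta_moment_eq:
  "eta_moment m S Om H i =
    (\<Sum>w\<in>words_of_kind m i. trace (Om ** string_prod (\<lambda>k. S ** H k) w))"
  unfolding eta_moment_def by (rule sum_necklace_reps)

lemma rho_moment_eq:
  assumes "i \<noteq> 0"
  shows "of_nat (mi_size i) * rho_moment m S H i =
    (\<Sum>w\<in>words_of_kind m i. trace (string_prod (\<lambda>k. S ** H k) w))"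
proof -
  let ?R = "necklace_reps m i" and ?Q = "aperiodic_necklace_reps m i" and ?l = "mi_size i"
  let ?t = "\<lambda>w. trace (string_prod (\<lambda>k. S ** H k) w)"
  have l: "of_nat ?l \<noteq> (0 :: complex)" using assms by (simp add: mi_size_eq_0_iff)
  have sub: "?Q \<subseteq> ?R" by (auto simp: aperiodic_necklace_reps_eq)
  \<comment> \<open>For an aperiodic representative the quotient of period by length is
    \<open>1\<close>, so both sums acquire the same weight and can be merged.\<close>
  have "rho_moment m S H i =
      (\<Sum>a\<in>?Q. of_nat (necklace_period a) / of_nat ?l * ?t a) +
      (\<Sum>a\<in>?R - ?Q. of_nat (necklace_period a) / of_nat ?l * ?t a)"
    unfolding rho_moment_def using l
    by (intro arg_cong2[where f = "(+)"] sum.cong) (auto simp: aperiodic_necklace_reps_eq)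
  also have "\<dots> = (\<Sum>a\<in>?R. of_nat (necklace_period a) / of_nat ?l * ?t a)"
    by (subst sum.subset_diff[OF sub finite_necklace_reps]) (rule add.commute)
  finally have "of_nat ?l * rho_moment m S H i = (\<Sum>a\<in>?R. of_nat (necklace_period a) * ?t a)"
    using l by (simp add: sum_distrib_left)
  also have "\<dots> = (\<Sum>a\<in>?R. \<Sum>b\<in>necklace a. ?t b)"
  proof (rule sum.cong[OF refl])
    fix a
    \<comment> \<open>Rotation invariance of the trace makes the summand constant on the class, and
      the period counts its strings.\<close>
    have "(\<Sum>b\<in>necklace a. ?t b) = (\<Sum>b\<in>necklace a. ?t a)"
      by (rule sum.cong) (auto simp: mem_necklace_iff trace_string_prod_rotate)
    then show "of_nat (necklace_period a) * ?t a = (\<Sum>b\<in>necklace a. ?t b)"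
      by (simp add: necklace_period_def)
  qed
  also have "\<dots> = (\<Sum>w\<in>words_of_kind m i. ?t w)" by (rule sum_necklace_reps)
  finally show ?thesis .
qed

end

theorem theorem18:
  fixes n m :: nat
    and S M Om :: "complex^'p^'p"
    and mu :: "nat \<Rightarrow> complex^'p^1"
    and H :: "nat \<Rightarrow> complex^'p^'p"
    and i :: "nat \<Rightarrow>\<^sub>0 nat"
  assumes "n > 0" and "m > 0"
    and "covariance_matrix S" and "rank S = CARD('p)"
    and "M = (\<Sum>k=1..n. conj_transpose (mu k) ** mu k)"
    and "Om = matrix_inv S ** M"
    and "Poly_Mapping.keys i \<subseteq> {1..m}" and "i \<noteq> 0"
  shows "joint_cumulant (wishart_mgf n S Om m H) i =
    of_nat (mi_fact i) * (of_nat n * rho_moment m S H i - eta_moment m S Om H i)"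
proof -
  \<comment> \<open>The Euler derivation determines a coefficient only up to the factor
    \<open>mi_size i\<close>; as \<open>i\<close> is nonzero, this factor can be cancelled at the
    end.\<close>
  have l: "of_nat (mi_size i) \<noteq> (0 :: complex)"
    using \<open>i \<noteq> 0\<close> by (simp add: mi_size_eq_0_iff)
  have "of_nat (mi_size i) * mfps_nth (mfps_ln (wishart_mgf n S Om m H)) i =
      of_nat n * (of_nat (mi_size i) * rho_moment m S H i) -
      of_nat (mi_size i) * eta_moment m S Om H i"
    by (simp only: mfps_ln_wishart_mgf[OF assms(8)] rho_moment_eq[OF assms(7,8)]
        eta_moment_eq[OF assms(7)])
  also have "\<dots> = of_nat (mi_size i) * (of_nat n * rho_moment m S H i - eta_moment m S Om H i)"
    by (simp add: algebra_simps)
  finally show ?thesis using l by (simp add: joint_cumulant_def)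
qed

end
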